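(* Let $G$ be a finite abelian group, $V$ a nonzero finite dimensional $G$-graded vector space over a field $k$, and $A=\mathrm{END}_k(V)$. Then there is an exact sequence of groups $$0\longrightarrow\mathrm{INN}(A)\longrightarrow\mathrm{Aut}_{\mathrm{gr}}(A)\stackrel{\phi}{\longrightarrow}\mathcal{I}(V)\longrightarrow0,$$ where the first map is the inclusion and, for $\gamma\in\mathrm{Aut}_{\mathrm{gr}}(A)$, $\phi(\gamma)$ is the element $\sigma\in G$ such that the one-dimensional graded subspace $I=\{x\in A\mid x\gamma(a)=ax\text{ for all }a\in A\}$ of $A$ is isomorphic to $k(\sigma)$ as a graded vector space.
   Context: For a finite dimensional $G$-graded space $V=\bigoplus_{g\in G}V_g$, $\mathrm{END}_k(V)$ is the algebra $\mathrm{End}_k(V)$ with the $G$-grading $\mathrm{END}_k(V)_\sigma=\{f\mid f(V_g)\subseteq V_{\sigma g}\ \forall g\in G\}$; elements of $\mathrm{END}_k(V)_\sigma$ are called homogeneous of degree $\sigma$. $V(\sigma)$ is $V$ with grading $V(\sigma)_g=V_{g\sigma}$, and $\mathcal{I}(V)=\{\sigma\in G\mid V(\sigma)\cong V\text{ as graded vector spaces}\}$, a subgroup of $G$. $k$ is viewed as a graded vector space concentrated in degree $e$, so $k(\sigma)$ is a one-dimensional graded vector space; every one-dimensional graded vector space is isomorphic to $k(\sigma)$ for a unique $\sigma\in G$. $\mathrm{Aut}_{\mathrm{gr}}(A)$ is the group of degree-preserving $k$-algebra automorphisms of $A$ (algebra automorphisms of degree $e$), and $\mathrm{INN}(A)$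 is its subgroup of inner automorphisms $a\mapsto faf^{-1}$ induced by a linear automorphism $f$ of $V$ of degree $e$ (i.e. $f(V_g)=V_g$ for all $g$). *)

theory Defs
  imports
    "HOL-Algebra.Algebra"
    "HOL-Library.Function_Algebras"
begin

text \<open>
  A graded vector space over the type-class field \<open>'k\<close> is given by a scalar
  multiplication \<open>scale\<close> on an ambient type, an underlying subspace \<open>S\<close> (\<open>UNIV\<close> for \<open>V\<close> itself)
  and the family \<open>W\<close> of homogeneous components.  Only the values of \<open>W\<close> on
  \<open>carrier G\<close> matter.  The group \<open>G\<close> is finite throughout, so that decompositions into
  homogeneous components are sums over all of \<open>carrier G\<close>.
\<close>

definition grading ::
    "('g, 'm) monoid_scheme \<Rightarrow> ('k::field \<Rightarrow> 'w \<Rightarrow> 'w::ab_group_add) \<Rightarrow> 'w set \<Rightarrow> ('g \<Rightarrow> 'w set) \<Rightarrow> bool"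
  where "grading G scale S W \<longleftrightarrow>
    module.subspace scale S \<and>
    (\<forall>g\<in>carrier G. module.subspace scale (W g) \<and> W g \<subseteq> S) \<and>
    (\<forall>v\<in>S. \<exists>!w. w \<in> (\<Pi>\<^sub>E g\<in>carrier G. W g) \<and> v = (\<Sum>g\<in>carrier G. w g))"

definition graded_isomorphic ::
    "('g, 'm) monoid_scheme \<Rightarrow>
     ('k::field \<Rightarrow> 'w \<Rightarrow> 'w::ab_group_add) \<Rightarrow> 'w set \<Rightarrow> ('g \<Rightarrow> 'w set) \<Rightarrow>
     ('k \<Rightarrow> 'u \<Rightarrow> 'u::ab_group_add) \<Rightarrow> 'u set \<Rightarrow> ('g \<Rightarrow> 'u set) \<Rightarrow> bool"
  where "graded_isomorphic G scale1 S1 W1 scale2 S2 W2 \<longleftrightarrow>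
    (\<exists>f. bij_betw f S1 S2 \<and>
         (\<forall>x\<in>S1. \<forall>y\<in>S1. f (x + y) = f x + f y) \<and>
         (\<forall>c. \<forall>x\<in>S1. f (scale1 c x) = scale2 c (f x)) \<and>
         (\<forall>g\<in>carrier G. f ` W1 g = W2 g))"

definition shift :: "('g, 'm) monoid_scheme \<Rightarrow> ('g \<Rightarrow> 'w set) \<Rightarrow> 'g \<Rightarrow> ('g \<Rightarrow> 'w set)"
  where "shift G W \<sigma> = (\<lambda>g. W (g \<otimes>\<^bsub>G\<^esub> \<sigma>))"

text \<open>
  With this convention for shifts, \<open>k(\<sigma>)\<close>, that is \<open>shift G (ground_grading G) \<sigma>\<close>, lives in
  degree \<open>inv \<sigma>\<close>.
\<close>

definition ground_grading :: "('g, 'm) monoid_scheme \<Rightarrow> 'g \<Rightarrow> 'k::field set"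
  where "ground_grading G g = (if g = \<one>\<^bsub>G\<^esub> then UNIV else {0})"

definition inertia_group ::
    "('g, 'm) monoid_scheme \<Rightarrow> ('k::field \<Rightarrow> 'v \<Rightarrow> 'v::ab_group_add) \<Rightarrow> ('g \<Rightarrow> 'v set) \<Rightarrow>
     ('g, 'm) monoid_scheme"
  where "inertia_group G scale V = G\<lparr>carrier :=
    {\<sigma> \<in> carrier G. graded_isomorphic G scale UNIV (shift G V \<sigma>) scale UNIV V}\<rparr>"

text \<open>
  Zero, addition and scaling of endomorphisms are pointwise; the product is composition.
\<close>

definition END :: "('k::field \<Rightarrow> 'v \<Rightarrow> 'v::ab_group_add) \<Rightarrow> ('k, 'v \<Rightarrow> 'v) module"
  where "END scale =
    \<lparr>carrier = {f. Vector_Spaces.linear scale scale f}, monoid.mult = (\<circ>), monoid.one = id,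
     ring.zero = 0, ring.add = (+), smult = (\<lambda>c f v. scale c (f v))\<rparr>"

definition END_deg ::
    "('g, 'm) monoid_scheme \<Rightarrow> ('k::field \<Rightarrow> 'v \<Rightarrow> 'v::ab_group_add) \<Rightarrow> ('g \<Rightarrow> 'v set) \<Rightarrow>
     'g \<Rightarrow> ('v \<Rightarrow> 'v) set"
  where "END_deg G scale V \<sigma> =
    {f \<in> carrier (END scale). \<forall>g\<in>carrier G. f ` V g \<subseteq> V (\<sigma> \<otimes>\<^bsub>G\<^esub> g)}"

text \<open>
  As for \<^const>\<open>AutoGroup\<close>, automorphisms are extensional functions on the carrier.
\<close>

definition Aut_gr ::
    "('g, 'm) monoid_scheme \<Rightarrow> ('k::field, 'a) module \<Rightarrow> ('g \<Rightarrow> 'a set) \<Rightarrow> ('a \<Rightarrow> 'a) monoid"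
  where "Aut_gr G A D = BijGroup (carrier A)\<lparr>carrier :=
    {\<gamma> \<in> Bij (carrier A).
       \<gamma> \<in> ring_iso A A \<and>
       (\<forall>c. \<forall>a\<in>carrier A. \<gamma> (c \<odot>\<^bsub>A\<^esub> a) = c \<odot>\<^bsub>A\<^esub> \<gamma> a) \<and>
       (\<forall>\<sigma>\<in>carrier G. \<gamma> ` D \<sigma> \<subseteq> D \<sigma>)}\<rparr>"

definition INN ::
    "('g, 'm) monoid_scheme \<Rightarrow> ('k::field \<Rightarrow> 'v \<Rightarrow> 'v::ab_group_add) \<Rightarrow> ('g \<Rightarrow> 'v set) \<Rightarrow>
     (('v \<Rightarrow> 'v) \<Rightarrow> ('v \<Rightarrow> 'v)) monoid"
  where "INN G scale V = BijGroup (carrier (END scale))\<lparr>carrier :=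
    {(\<lambda>a\<in>carrier (END scale). f \<circ> a \<circ> inv_into UNIV f) | f.
       Vector_Spaces.linear scale scale f \<and> bij f \<and> (\<forall>g\<in>carrier G. f ` V g = V g)}\<rparr>"

definition twisted_centralizer :: "('k::field, 'a) module \<Rightarrow> ('a \<Rightarrow> 'a) \<Rightarrow> 'a set"
  where "twisted_centralizer A \<gamma> =
    {x \<in> carrier A. \<forall>a\<in>carrier A. x \<otimes>\<^bsub>A\<^esub> \<gamma> a = a \<otimes>\<^bsub>A\<^esub> x}"

definition twisted_centralizer_deg ::
    "('g, 'm) monoid_scheme \<Rightarrow> ('k::field \<Rightarrow> 'v \<Rightarrow> 'v::ab_group_add) \<Rightarrow> ('g \<Rightarrow> 'v set) \<Rightarrow>
     (('v \<Rightarrow> 'v) \<Rightarrow> ('v \<Rightarrow> 'v)) \<Rightarrow> 'g \<Rightarrow> ('v \<Rightarrow> 'v) set"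
  where "twisted_centralizer_deg G scale V \<gamma> \<sigma> =
    twisted_centralizer (END scale) \<gamma> \<inter> END_deg G scale V \<sigma>"

definition twist_type ::
    "('g, 'm) monoid_scheme \<Rightarrow> ('k::field \<Rightarrow> 'v \<Rightarrow> 'v::ab_group_add) \<Rightarrow> ('g \<Rightarrow> 'v set) \<Rightarrow>
     (('v \<Rightarrow> 'v) \<Rightarrow> ('v \<Rightarrow> 'v)) \<Rightarrow> 'g \<Rightarrow> bool"
  where "twist_type G scale V \<gamma> \<sigma> \<longleftrightarrow>
    graded_isomorphic G
      (smult (END scale)) (twisted_centralizer (END scale) \<gamma>) (twisted_centralizer_deg G scale V \<gamma>)
      ((*) :: 'k \<Rightarrow> 'k \<Rightarrow> 'k) UNIV (shift G (ground_grading G) \<sigma>)"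

definition phi ::
    "('g, 'm) monoid_scheme \<Rightarrow> ('k::field \<Rightarrow> 'v \<Rightarrow> 'v::ab_group_add) \<Rightarrow> ('g \<Rightarrow> 'v set) \<Rightarrow>
     (('v \<Rightarrow> 'v) \<Rightarrow> ('v \<Rightarrow> 'v)) \<Rightarrow> 'g"
  where "phi G scale V \<gamma> = (THE \<sigma>. \<sigma> \<in> carrier G \<and> twist_type G scale V \<gamma> \<sigma>)"

text \<open>
  The library's \<^const>\<open>exact_seq\<close> requires all groups of a sequence to have the same element type.
\<close>

definition short_exact_groups ::
    "('a, 'x) monoid_scheme \<Rightarrow> ('a \<Rightarrow> 'b) \<Rightarrow> ('b, 'y) monoid_scheme \<Rightarrow> ('b \<Rightarrow> 'c) \<Rightarrow>
     ('c, 'z) monoid_scheme \<Rightarrow> bool"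
  where "short_exact_groups K i H p Q \<longleftrightarrow>
    group_hom K H i \<and> group_hom H Q p \<and>
    inj_on i (carrier K) \<and> i ` carrier K = kernel H Q p \<and> p ` carrier H = carrier Q"

end

theory Submission
  imports Defs
begin

text \<open>
  Call a linear bijection \<open>u\<close> of \<open>V\<close> homogeneous of degree \<open>\<sigma>\<close> if \<open>u(V\<^sub>g) = V\<^bsub>\<sigma>g\<^esub>\<close> for all \<open>g\<close>.  The
  whole statement comes from describing \<open>Aut\<^sub>g\<^sub>r(A)\<close> as the group of conjugations
  \<open>a \<mapsto> u a u\<^sup>-\<^sup>1\<close> by such maps, on which \<open>\<phi>\<close> is the degree of \<open>u\<close>.

  That every graded automorphism \<open>\<gamma>\<close> is of this form (\<open>Aut_gr_is_conj_by\<close>) is a graded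
  Skolem--Noether theorem.  Take a homogeneous vector \<open>e\<close> and a functional \<open>l\<close> that
  vanishes outside the component of \<open>e\<close> and has \<open>l(e) = 1\<close>, and put \<open>u(v) = \<gamma>(l(-) v)(w)\<close> for a
  homogeneous vector \<open>w\<close> with \<open>u(e) \<noteq> 0\<close>.  Then \<open>u a = \<gamma>(a) u\<close> for all \<open>a\<close>, whence \<open>u\<close> is bijective
  (\<open>intertwiner_bij\<close>) and \<open>\<gamma>\<close> is conjugation by \<open>u\<close>; and since \<open>\<gamma>\<close> preserves the degree of the
  rank-one map \<open>l(-) v\<close> and \<open>G\<close> is abelian, \<open>u\<close> is homogeneous.  Conversely, as \<open>G\<close> is
  abelian, conjugation by any homogeneous \<open>u\<close> preserves degrees (\<open>conj_by_in_Aut_gr\<close>).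

  For \<open>\<gamma>\<close> conjugation by \<open>u\<close>, the elements \<open>x\<close> with \<open>x \<gamma>(a) = a x\<close> are those for which \<open>x u\<close> is
  central, that is, a scalar.  So \<open>I = k u\<^sup>-\<^sup>1\<close> (\<open>twisted_centralizer_conj_by\<close>), a line concentrated in
  degree \<open>\<sigma>\<^sup>-\<^sup>1\<close> when \<open>u\<close> has degree \<open>\<sigma>\<close>.  This is the degree in which \<open>k(\<sigma>)\<close> lives, so
  \<open>\<phi>(\<gamma>) = \<sigma>\<close> (\<open>twist_type_conj_by\<close>).

  Exactness is now immediate.  Degrees multiply under composition; the conjugations by maps of
  trivial degree form \<open>INN(A)\<close> by definition; and \<open>\<sigma>\<close> is the degree of some homogeneous bijection
  exactly when \<open>V(\<sigma>) \<cong> V\<close>, because the inverse of such a bijection is an isomorphism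
  \<open>V(\<sigma>) \<rightarrow> V\<close>.
\<close>

section \<open>The endomorphism algebra and its inner automorphisms\<close>

definition conj_by ::
    "('k::field \<Rightarrow> 'v \<Rightarrow> 'v::ab_group_add) \<Rightarrow> ('v \<Rightarrow> 'v) \<Rightarrow> ('v \<Rightarrow> 'v) \<Rightarrow> ('v \<Rightarrow> 'v)"
  where "conj_by scale u = (\<lambda>a\<in>carrier (END scale). u \<circ> a \<circ> inv_into UNIV u)"

definition homogeneous_iso ::
    "('g, 'm) monoid_scheme \<Rightarrow> ('k::field \<Rightarrow> 'v \<Rightarrow> 'v::ab_group_add) \<Rightarrow> ('g \<Rightarrow> 'v set) \<Rightarrow>
     'g \<Rightarrow> ('v \<Rightarrow> 'v) \<Rightarrow> bool"
  where "homogeneous_iso G scale V \<sigma> u \<longleftrightarrow>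
    Vector_Spaces.linear scale scale u \<and> bij u \<and>
    (\<forall>g\<in>carrier G. u ` V g = V (\<sigma> \<otimes>\<^bsub>G\<^esub> g))"

locale endomorphism_algebra = vector_space scale
  for scale :: "'a::field \<Rightarrow> 'b \<Rightarrow> 'b::ab_group_add" (infixr \<open>*s\<close> 75)
begin

abbreviation lin :: "('b \<Rightarrow> 'b) \<Rightarrow> bool"
  where "lin \<equiv> Vector_Spaces.linear scale scale"

lemma lin_iff: "lin f \<longleftrightarrow> (\<forall>x y. f (x + y) = f x + f y) \<and> (\<forall>c x. f (c *s x) = c *s f x)"
  using vector_space_axioms by (simp add: Vector_Spaces.linear_iff)

lemma linD:
  assumes "lin f"
  shows "f (x + y) = f x + f y" and "f (c *s x) = c *s f x"
    and "f 0 = 0" and "f (sum w A) = (\<Sum>i\<in>A. f (w i))"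
proof -
  interpret additive f
    using assms by unfold_locales (simp add: lin_iff)
  show "f (x + y) = f x + f y" "f (c *s x) = c *s f x" using assms by (simp_all add: lin_iff)
  show "f 0 = 0" "f (sum w A) = (\<Sum>i\<in>A. f (w i))" by (simp_all add: zero sum)
qed

lemma carrier_END: "carrier (END scale) = {f. lin f}"
  and mult_END: "monoid.mult (END scale) = (\<circ>)"
  and one_END: "monoid.one (END scale) = id"
  and add_END: "ring.add (END scale) = (+)"
  and smult_END: "smult (END scale) = (\<lambda>c f v. c *s f v)"
  by (simp_all add: END_def)

lemma vector_space_fun: "vector_space (\<lambda>c (f :: 'c \<Rightarrow> 'b) v. c *s f v)"
  by unfold_locales (auto simp: fun_eq_iff algebra_simps)

lemma lin_comp: "lin f \<Longrightarrow> lin g \<Longrightarrow> lin (f \<circ> g)"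
  by (simp add: lin_iff)

lemma lin_inv_into: "lin u \<Longrightarrow> bij u \<Longrightarrow> lin (inv_into UNIV u)"
  unfolding lin_iff by (metis bij_inv_eq_iff)

lemma ex_functional:
  assumes "v \<noteq> 0"
  shows "\<exists>l. Vector_Spaces.linear scale (*) l \<and> l v = 1"
proof -
  interpret vector_space_pair scale "(*)"
    by unfold_locales (auto simp: algebra_simps)
  have "independent {v}"
    using assms by (simp add: dependent_single)
  from linear_independent_extend[OF this, of "\<lambda>_. 1"] show ?thesis
    by auto
qed

lemma functionalD:
  assumes "Vector_Spaces.linear scale (*) l"
  shows "l (x + y) = l x + l y" and "l (c *s x) = c * l x"
  using assms by (auto simp: Vector_Spaces.linear_iff)

lemma lin_rank_one:
  assumes "Vector_Spaces.linear scale (*) l"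
  shows "lin (\<lambda>x. l x *s v)"
  by (simp add: lin_iff functionalD[OF assms] algebra_simps)

lemma ex_lin:
  assumes "v \<noteq> 0"
  shows "\<exists>a. lin a \<and> a v = w"
proof -
  obtain l where l: "Vector_Spaces.linear scale (*) l" "l v = 1"
    using ex_functional[OF assms] by blast
  show ?thesis
    using lin_rank_one[OF l(1), of w] l(2) by (intro exI[of _ "\<lambda>x. l x *s w"]) simp
qed

text \<open>
  The centre of \<open>End(V)\<close> is \<open>k\<close>.  With a functional \<open>l\<close> such that \<open>l e = 1\<close>, the rank-one map
  \<open>l(-) v\<close> sends \<open>e\<close> to \<open>v\<close>, so commuting with it forces \<open>x v = l(x e) v\<close>, and the factor
  \<open>l(x e)\<close> does not depend on \<open>v\<close>.
\<close>

lemma central_lin_imp_scalar: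
  assumes x: "lin x" and comm: "\<And>a. lin a \<Longrightarrow> x \<circ> a = a \<circ> x"
  shows "\<exists>c. x = (\<lambda>v. c *s v)"
proof (cases "\<exists>e. (e::'b) \<noteq> 0")
  case True
  then obtain e :: 'b where "e \<noteq> 0" by blast
  then obtain l where l: "Vector_Spaces.linear scale (*) l" "l e = 1"
    using ex_functional by blast
  have "x v = l (x e) *s v" for v
    using fun_cong[OF comm[OF lin_rank_one[OF l(1), of v]], of e] l(2) by simp
  then show ?thesis by blast
next
  case False
  then show ?thesis by (intro exI[of _ 0]) auto
qed

text \<open>
  A nonzero map that intertwines the standard module with its twist by a surjective \<open>\<gamma>\<close> is
  bijective, because both modules are simple in the strong sense that every nonzero vector can
  be moved to every other vector by some endomorphism.
\<close>

lemma intertwiner_bij: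
  assumes u: "lin u" and ue: "u e \<noteq> 0"
    and \<gamma>: "\<And>a. lin a \<Longrightarrow> lin (\<gamma> a)"
    and surj: "\<And>b. lin b \<Longrightarrow> \<exists>a. lin a \<and> \<gamma> a = b"
    and inter: "\<And>a. lin a \<Longrightarrow> \<gamma> a \<circ> u = u \<circ> a"
  shows "bij u"
proof (rule bijI)
  have ker: "v = 0" if "u v = 0" for v
  proof (rule ccontr)
    assume "v \<noteq> 0"
    then obtain a where a: "lin a" "a v = e"
      using ex_lin by blast
    have "u e = \<gamma> a (u v)"
      using fun_cong[OF inter[OF a(1)], of v] a(2) by simp
    then show False
      using ue that linD(3)[OF \<gamma>[OF a(1)]] by simp
  qed
  show "inj u"
  proof (rule injI)
    fix x y
    assume "u x = u y"
    moreover have "u x = u (x - y) + u y"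
      using linD(1)[OF u, of "x - y" y] by simp
    ultimately show "x = y"
      using ker[of "x - y"] by simp
  qed
  show "surj u"
  proof (rule surjI)
    fix y
    obtain b where b: "lin b" "b (u e) = y"
      using ex_lin[OF ue] by blast
    then obtain a where a: "lin a" "\<gamma> a = b"
      using surj by blast
    then have "u (a e) = y"
      using fun_cong[OF inter[OF a(1)], of e] b(2) by simp
    then show "u (inv_into UNIV u y) = y"
      by (metis f_inv_into_f rangeI)
  qed
qed

lemma conj_by_apply: "lin a \<Longrightarrow> conj_by scale u a = u \<circ> a \<circ> inv_into UNIV u"
  by (simp add: conj_by_def carrier_END)

lemma lin_conj_by: "lin u \<Longrightarrow> bij u \<Longrightarrow> lin a \<Longrightarrow> lin (conj_by scale u a)"
  by (simp add: conj_by_apply lin_comp lin_inv_into)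

lemma conj_by_comp_self: "bij u \<Longrightarrow> lin a \<Longrightarrow> conj_by scale u a \<circ> u = u \<circ> a"
  by (simp add: conj_by_apply fun_eq_iff bij_is_inj)

lemma conj_by_conj_by:
  assumes "lin u" "bij u" "lin u'" "bij u'" "lin a"
  shows "conj_by scale u (conj_by scale u' a) = conj_by scale (u \<circ> u') a"
proof -
  have "lin (conj_by scale u' a)"
    using assms lin_conj_by by blast
  then show ?thesis
    using assms by (simp only: conj_by_apply o_inv_distrib comp_assoc)
qed

lemma conj_by_identity: "conj_by scale id = (\<lambda>a\<in>carrier (END scale). a)"
  by (simp add: conj_by_def)

lemma conj_by_inv_cancel:
  assumes "lin u" "bij u" "lin a"
  shows "conj_by scale (inv_into UNIV u) (conj_by scale u a) = a"
    and "conj_by scale u (conj_by scale (inv_into UNIV u) a) = a"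
  using assms
  by (simp_all add: conj_by_conj_by lin_inv_into bij_imp_bij_inv conj_by_identity carrier_END bij_is_inj
      bij_is_surj surj_iff[THEN iffD1])

lemma conj_by_Bij:
  assumes "lin u" "bij u"
  shows "conj_by scale u \<in> Bij (carrier (END scale))"
proof -
  have "bij_betw (conj_by scale u) (carrier (END scale)) (carrier (END scale))"
    by (rule bij_betw_byWitness[where f' = "conj_by scale (inv_into UNIV u)"])
      (use assms in \<open>auto simp: carrier_END conj_by_inv_cancel lin_conj_by lin_inv_into bij_imp_bij_inv\<close>)
  then show ?thesis
    by (simp add: Bij_def conj_by_def)
qed

lemma conj_by_mult:
  assumes "lin u" "bij u" "lin u'" "bij u'"
  shows "conj_by scale u \<otimes>\<^bsub>BijGroup (carrier (END scale))\<^esub> conj_by scale u' = conj_by scale (u \<circ> u')"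
proof -
  have "compose (carrier (END scale)) (conj_by scale u) (conj_by scale u') = conj_by scale (u \<circ> u')"
  proof
    fix a
    show "compose (carrier (END scale)) (conj_by scale u) (conj_by scale u') a = conj_by scale (u \<circ> u') a"
    proof (cases "lin a")
      case True
      then show ?thesis
        using conj_by_conj_by[OF assms] by (simp add: compose_def carrier_END)
    next
      case False
      then show ?thesis
        by (simp add: compose_def carrier_END conj_by_def)
    qed
  qed
  then show ?thesis
    using assms by (simp add: BijGroup_def conj_by_Bij)
qed

lemma conj_by_inv:
  assumes "lin u" "bij u"
  shows "inv\<^bsub>BijGroup (carrier (END scale))\<^esub> (conj_by scale u) = conj_by scale (inv_into UNIV u)"
proof (rule group.inv_equality[OF group_BijGroup])
  show "conj_by scale (inv_into UNIV u) \<otimes>\<^bsub>BijGroup (carrier (END scale))\<^esub> conj_by scale u =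
      \<one>\<^bsub>BijGroup (carrier (END scale))\<^esub>"
    using assms by (simp add: conj_by_mult lin_inv_into bij_imp_bij_inv bij_is_inj conj_by_identity)
      (simp add: BijGroup_def)
qed (use assms in \<open>simp_all add: BijGroup_def conj_by_Bij lin_inv_into bij_imp_bij_inv\<close>)

text \<open>
  Together with \<open>conj_by_Bij\<close> above and \<open>conj_by_smult\<close> below, this makes conjugation by a
  linear bijection an automorphism of the algebra \<open>END scale\<close>.
\<close>

lemma conj_by_ring_iso:
  assumes "lin u" "bij u"
  shows "conj_by scale u \<in> ring_iso (END scale) (END scale)"
proof -
  have "conj_by scale u \<in> ring_hom (END scale) (END scale)"
  proof (rule ring_hom_memI)
    fix a b
    assume "a \<in> carrier (END scale)" "b \<in> carrier (END scale)"
    then have ab: "lin a" "lin b" by (simp_all add: carrier_END)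
    show "conj_by scale u (a \<otimes>\<^bsub>END scale\<^esub> b) = conj_by scale u a \<otimes>\<^bsub>END scale\<^esub> conj_by scale u b"
      using ab assms by (simp add: mult_END conj_by_apply lin_comp fun_eq_iff bij_is_inj)
    have "lin (a + b)"
      using ab by (simp add: lin_iff algebra_simps)
    then show "conj_by scale u (a \<oplus>\<^bsub>END scale\<^esub> b) = conj_by scale u a \<oplus>\<^bsub>END scale\<^esub> conj_by scale u b"
      using ab linD(1)[OF assms(1)] by (simp add: add_END conj_by_apply fun_eq_iff)
  next
    have "lin id" by (simp add: lin_iff)
    then show "conj_by scale u \<one>\<^bsub>END scale\<^esub> = \<one>\<^bsub>END scale\<^esub>"
      using assms by (simp add: one_END conj_by_apply bij_is_surj surj_iff[THEN iffD1])
  qed (use assms in \<open>simp_all add: carrier_END lin_conj_by\<close>)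
  then show ?thesis
    using conj_by_Bij[OF assms] by (simp add: ring_iso_def Bij_def)
qed

lemma conj_by_smult:
  assumes "lin u" "a \<in> carrier (END scale)"
  shows "conj_by scale u (c \<odot>\<^bsub>END scale\<^esub> a) = c \<odot>\<^bsub>END scale\<^esub> conj_by scale u a"
proof -
  have a: "lin a"
    using assms(2) by (simp add: carrier_END)
  then have "lin (\<lambda>v. c *s a v)"
    by (simp add: lin_iff algebra_simps)
  then show ?thesis
    using a linD(2)[OF assms(1)] by (simp add: smult_END conj_by_apply fun_eq_iff)
qed

text \<open>
  The condition \<open>x \<circ> u a u\<^sup>-\<^sup>1 = a \<circ> x\<close> says exactly that \<open>x \<circ> u\<close> commutes with \<open>a\<close>.  So \<open>x \<circ> u\<close> is
  central, hence a scalar, and the twisted centralizer is the line through \<open>u\<^sup>-\<^sup>1\<close>.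
\<close>

lemma twisted_centralizer_conj_by:
  assumes u: "lin u" "bij u"
  shows "twisted_centralizer (END scale) (conj_by scale u) =
    range (\<lambda>c. smult (END scale) c (inv_into UNIV u))"
proof (intro equalityI subsetI)
  fix x
  assume "x \<in> twisted_centralizer (END scale) (conj_by scale u)"
  then have x: "lin x" and comm: "\<And>a. lin a \<Longrightarrow> x \<circ> conj_by scale u a = a \<circ> x"
    by (auto simp: twisted_centralizer_def carrier_END mult_END)
  have "(x \<circ> u) \<circ> a = a \<circ> (x \<circ> u)" if "lin a" for a
    by (metis comm conj_by_comp_self comp_assoc that u(2))
  then obtain c where "x \<circ> u = (\<lambda>v. c *s v)"
    using central_lin_imp_scalar lin_comp[OF x u(1)] by blast
  then have "x (u w) = c *s w" for w
    by (simp add: fun_eq_iff)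
  then have "x v = c *s inv_into UNIV u v" for v
    using u(2) by (metis bij_inv_eq_iff)
  then show "x \<in> range (\<lambda>c. smult (END scale) c (inv_into UNIV u))"
    by (auto simp: smult_END)
next
  fix x
  assume "x \<in> range (\<lambda>c. smult (END scale) c (inv_into UNIV u))"
  then obtain c where x: "x = (\<lambda>v. c *s inv_into UNIV u v)"
    by (auto simp: smult_END)
  have "lin x"
    using linD[OF lin_inv_into[OF u]] unfolding x by (simp add: lin_iff algebra_simps)
  moreover have "x \<circ> conj_by scale u a = a \<circ> x" if "lin a" for a
    using that u(2) linD(2)[OF that] by (simp add: x conj_by_apply fun_eq_iff bij_is_inj)
  ultimately show "x \<in> twisted_centralizer (END scale) (conj_by scale u)"
    by (simp add: twisted_centralizer_def carrier_END mult_END)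
qed

end

section \<open>Homogeneous components and homogeneous isomorphisms\<close>

locale graded_space = endomorphism_algebra scale + G?: comm_group G
  for G :: "('g, 'm) monoid_scheme" (structure)
    and scale :: "'k::field \<Rightarrow> 'v \<Rightarrow> 'v::ab_group_add" (infixr \<open>*s\<close> 75) +
  fixes V :: "'g \<Rightarrow> 'v set"
  assumes finite_G: "finite (carrier G)"
    and grading_V: "grading G scale UNIV V"
begin

lemma inv_cancel:
  assumes "\<sigma> \<in> carrier G" "g \<in> carrier G"
  shows "\<sigma> \<otimes> (inv\<^bsub>G\<^esub> \<sigma> \<otimes> g) = g" and "inv\<^bsub>G\<^esub> \<sigma> \<otimes> (\<sigma> \<otimes> g) = g"
  using assms G.m_assoc[of \<sigma> "inv\<^bsub>G\<^esub> \<sigma>" g] G.m_assoc[of "inv\<^bsub>G\<^esub> \<sigma>" \<sigma> g] by simp_all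

text \<open>
  Meaningful only for \<open>g\<close> in the carrier, where \<open>w\<close> is the unique extensional family of components.
\<close>

definition hcomp :: "'g \<Rightarrow> 'v \<Rightarrow> 'v"
  where "hcomp g v = (THE w. w \<in> (\<Pi>\<^sub>E g\<in>carrier G. V g) \<and> v = (\<Sum>g\<in>carrier G. w g)) g"

lemma subspace_V: "g \<in> carrier G \<Longrightarrow> subspace (V g)"
  using grading_V by (simp add: grading_def)

lemma hcomp_unique:
  assumes "\<And>g. g \<in> carrier G \<Longrightarrow> w g \<in> V g" and "v = (\<Sum>g\<in>carrier G. w g)" and "g \<in> carrier G"
  shows "hcomp g v = w g"
proof -
  have ex1: "\<exists>!w. w \<in> (\<Pi>\<^sub>E g\<in>carrier G. V g) \<and> v = (\<Sum>g\<in>carrier G. w g)"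
    using grading_V by (simp add: grading_def)
  have "restrict w (carrier G) \<in> (\<Pi>\<^sub>E g\<in>carrier G. V g) \<and> v = (\<Sum>g\<in>carrier G. restrict w (carrier G) g)"
    using assms by auto
  then have "(THE w. w \<in> (\<Pi>\<^sub>E g\<in>carrier G. V g) \<and> v = (\<Sum>g\<in>carrier G. w g)) = restrict w (carrier G)"
    by (rule the1_equality[OF ex1])
  then show ?thesis
    using assms(3) by (simp add: hcomp_def)
qed

lemma hcomp_decomposition:
  shows hcomp_in: "g \<in> carrier G \<Longrightarrow> hcomp g v \<in> V g"
    and sum_hcomp: "(\<Sum>g\<in>carrier G. hcomp g v) = v"
proof -
  have ex1: "\<exists>!w. w \<in> (\<Pi>\<^sub>E g\<in>carrier G. V g) \<and> v = (\<Sum>g\<in>carrier G. w g)"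
    using grading_V by (simp add: grading_def)
  from theI'[OF this] show "g \<in> carrier G \<Longrightarrow> hcomp g v \<in> V g" "(\<Sum>g\<in>carrier G. hcomp g v) = v"
    by (auto simp: hcomp_def)
qed

lemma lin_hcomp:
  assumes "g \<in> carrier G"
  shows "lin (hcomp g)"
  unfolding lin_iff
proof (intro conjI allI)
  fix x y
  show "hcomp g (x + y) = hcomp g x + hcomp g y"
    using assms subspace_V hcomp_in
    by (intro hcomp_unique) (auto simp: subspace_add sum.distrib sum_hcomp)
next
  fix c x
  show "hcomp g (c *s x) = c *s hcomp g x"
    using assms subspace_V hcomp_in
    by (intro hcomp_unique) (auto simp: subspace_scale sum_hcomp simp flip: scale_sum_right)
qed

lemma hcomp_homogeneous:
  assumes "v \<in> V h" "h \<in> carrier G" "g \<in> carrier G"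
  shows "hcomp g v = (if g = h then v else 0)"
  using assms subspace_V finite_G
  by (intro hcomp_unique[where w = "\<lambda>g. if g = h then v else 0"]) (auto simp: subspace_0)

lemma V_disjoint:
  assumes "v \<in> V g" "v \<in> V h" "g \<in> carrier G" "h \<in> carrier G" "g \<noteq> h"
  shows "v = 0"
  using hcomp_homogeneous[OF assms(1,3,3)] hcomp_homogeneous[OF assms(2,4,3)] assms(5) by simp

lemma lin_nonzero_homogeneous:
  assumes "lin f" "f v \<noteq> 0"
  shows "\<exists>g\<in>carrier G. \<exists>w\<in>V g. f w \<noteq> 0"
proof (rule ccontr)
  assume neg: "\<not> ?thesis"
  have "f v = (\<Sum>g\<in>carrier G. f (hcomp g v))"
    using linD(4)[OF assms(1), of "\<lambda>g. hcomp g v" "carrier G"] by (simp add: sum_hcomp)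
  also have "\<dots> = 0"
    using neg hcomp_in by (intro sum.neutral) blast
  finally show False using assms(2) by simp
qed

abbreviation hiso :: "'g \<Rightarrow> ('v \<Rightarrow> 'v) \<Rightarrow> bool"
  where "hiso \<equiv> homogeneous_iso G scale V"

lemma hisoD:
  assumes "hiso \<sigma> u"
  shows "lin u" and "bij u" and "\<And>g. g \<in> carrier G \<Longrightarrow> u ` V g = V (\<sigma> \<otimes> g)"
  using assms by (auto simp: homogeneous_iso_def)

text \<open>
  The inverse of a bijection that shifts degrees by \<open>\<sigma>\<close> shifts them back: if \<open>u v\<close> lies in
  degree \<open>\<sigma> g\<close>, then comparing components shows that \<open>u\<close> kills every component of \<open>v\<close> in a
  degree \<open>h \<noteq> g\<close>, and injectivity makes these components zero.
\<close>

lemma bij_homogeneous_imp_hiso: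
  assumes u: "lin u" "bij u" and \<sigma>: "\<sigma> \<in> carrier G"
    and deg: "\<And>g. g \<in> carrier G \<Longrightarrow> u ` V g \<subseteq> V (\<sigma> \<otimes> g)"
  shows "hiso \<sigma> u"
proof -
  have "V (\<sigma> \<otimes> g) \<subseteq> u ` V g" if g: "g \<in> carrier G" for g
  proof
    fix y
    assume y: "y \<in> V (\<sigma> \<otimes> g)"
    obtain v where v: "y = u v"
      using u(2) by (metis bij_pointE)
    have bij: "bij_betw (\<lambda>k. inv\<^bsub>G\<^esub> \<sigma> \<otimes> k) (carrier G) (carrier G)"
      using \<sigma> by (simp add: bij_betw_def G.inj_on_cmult G.surj_const_mult)
    have "hcomp h v = 0" if h: "h \<in> carrier G" "h \<noteq> g" for h
    proof -
      have "u v = (\<Sum>k\<in>carrier G. u (hcomp k v))"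
        using linD(4)[OF u(1), of "\<lambda>g. hcomp g v" "carrier G"] by (simp add: sum_hcomp)
      also have "\<dots> = (\<Sum>k\<in>carrier G. u (hcomp (inv\<^bsub>G\<^esub> \<sigma> \<otimes> k) v))"
        by (rule sum.reindex_bij_betw[OF bij, symmetric])
      \<comment> \<open>the sum is indexed by the degree of the summand, so that uniqueness of components applies\<close>
      finally have uv: "u v = (\<Sum>k\<in>carrier G. u (hcomp (inv\<^bsub>G\<^esub> \<sigma> \<otimes> k) v))" .
      have "hcomp (\<sigma> \<otimes> h) (u v) = u (hcomp (inv\<^bsub>G\<^esub> \<sigma> \<otimes> (\<sigma> \<otimes> h)) v)"
      proof (rule hcomp_unique[where w = "\<lambda>k. u (hcomp (inv\<^bsub>G\<^esub> \<sigma> \<otimes> k) v)", OF _ uv])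
        fix k
        assume k: "k \<in> carrier G"
        have "u (hcomp (inv\<^bsub>G\<^esub> \<sigma> \<otimes> k) v) \<in> V (\<sigma> \<otimes> (inv\<^bsub>G\<^esub> \<sigma> \<otimes> k))"
          using k \<sigma> by (intro subsetD[OF deg] imageI hcomp_in) simp_all
        then show "u (hcomp (inv\<^bsub>G\<^esub> \<sigma> \<otimes> k) v) \<in> V k"
          using k \<sigma> by (simp add: inv_cancel)
      qed (use h \<sigma> in auto)
      then have "u (hcomp h v) = hcomp (\<sigma> \<otimes> h) y"
        using h \<sigma> v by (simp add: inv_cancel)
      also have "\<dots> = 0"
        using y h g \<sigma> by (subst hcomp_homogeneous[of _ "\<sigma> \<otimes> g"]) auto
      finally show ?thesis
        using linD(3)[OF u(1)] u(2) by (metis bij_pointE)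
    qed
    then have "v = hcomp g v"
      using sum_hcomp[of v] sum.remove[OF finite_G g, of "\<lambda>k. hcomp k v"] by simp
    then show "y \<in> u ` V g"
      using hcomp_in[OF g, of v] v by auto
  qed
  then have "u ` V g = V (\<sigma> \<otimes> g)" if "g \<in> carrier G" for g
    using deg that by blast
  then show ?thesis
    using u by (simp add: homogeneous_iso_def)
qed

lemma hiso_id: "hiso \<one> id"
  by (simp add: homogeneous_iso_def lin_iff)

lemma hiso_comp:
  assumes "hiso \<sigma> u" "hiso \<tau> v" "\<sigma> \<in> carrier G" "\<tau> \<in> carrier G"
  shows "hiso (\<sigma> \<otimes> \<tau>) (u \<circ> v)"
proof -
  have "(u \<circ> v) ` V g = V (\<sigma> \<otimes> \<tau> \<otimes> g)" if g: "g \<in> carrier G" for g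
    using hisoD(3)[OF assms(2) g] hisoD(3)[OF assms(1), of "\<tau> \<otimes> g"] assms(3,4) g
    by (simp only: image_comp[symmetric] G.m_assoc G.m_closed)
  then show ?thesis
    using hisoD(1,2)[OF assms(1)] hisoD(1,2)[OF assms(2)]
    by (simp add: homogeneous_iso_def lin_comp bij_comp)
qed

lemma hiso_inv:
  assumes u: "hiso \<sigma> u" and \<sigma>: "\<sigma> \<in> carrier G"
  shows "hiso (inv\<^bsub>G\<^esub> \<sigma>) (inv_into UNIV u)"
proof -
  have "inv_into UNIV u ` V g = V (inv\<^bsub>G\<^esub> \<sigma> \<otimes> g)" if g: "g \<in> carrier G" for g
  proof -
    have "V g = u ` V (inv\<^bsub>G\<^esub> \<sigma> \<otimes> g)"
      using hisoD(3)[OF u, of "inv\<^bsub>G\<^esub> \<sigma> \<otimes> g"] g \<sigma> by (simp add: inv_cancel)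
    then show ?thesis
      using hisoD(2)[OF u] by (simp add: image_inv_f_f bij_is_inj)
  qed
  then show ?thesis
    using hisoD(1,2)[OF u] by (simp add: homogeneous_iso_def lin_inv_into bij_imp_bij_inv)
qed

section \<open>Degrees in the endomorphism algebra\<close>

lemma END_degI:
  "lin f \<Longrightarrow> (\<And>g v. g \<in> carrier G \<Longrightarrow> v \<in> V g \<Longrightarrow> f v \<in> V (\<sigma> \<otimes> g)) \<Longrightarrow> f \<in> END_deg G scale V \<sigma>"
  by (auto simp: END_deg_def carrier_END)

lemma END_degD:
  assumes "f \<in> END_deg G scale V \<sigma>"
  shows "lin f" and "g \<in> carrier G \<Longrightarrow> v \<in> V g \<Longrightarrow> f v \<in> V (\<sigma> \<otimes> g)"
  using assms by (auto simp: END_deg_def carrier_END)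

lemma hiso_END_deg: "hiso \<sigma> u \<Longrightarrow> u \<in> END_deg G scale V \<sigma>"
  by (rule END_degI) (auto simp: hisoD(1) simp flip: hisoD(3))

lemma END_deg_comp:
  assumes "f \<in> END_deg G scale V \<sigma>" "h \<in> END_deg G scale V \<tau>" "\<sigma> \<in> carrier G" "\<tau> \<in> carrier G"
  shows "f \<circ> h \<in> END_deg G scale V (\<sigma> \<otimes> \<tau>)"
proof (rule END_degI)
  show "lin (f \<circ> h)" using assms END_degD(1) lin_comp by blast
  fix g v
  assume "g \<in> carrier G" "v \<in> V g"
  then show "(f \<circ> h) v \<in> V (\<sigma> \<otimes> \<tau> \<otimes> g)"
    using END_degD(2)[OF assms(1), of "\<tau> \<otimes> g" "h v"] END_degD(2)[OF assms(2)] assms(3,4)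
    by (simp add: G.m_assoc)
qed

lemma subspace_END_deg:
  assumes "\<sigma> \<in> carrier G"
  shows "module.subspace (smult (END scale)) (END_deg G scale V \<sigma>)"
proof -
  interpret F: vector_space "smult (END scale)"
    using vector_space_fun by (simp add: smult_END)
  show ?thesis
    unfolding F.subspace_def
  proof (intro conjI ballI allI)
    show "0 \<in> END_deg G scale V \<sigma>"
      using assms subspace_V by (intro END_degI) (auto simp: lin_iff subspace_0)
  next
    fix x y
    assume xy: "x \<in> END_deg G scale V \<sigma>" "y \<in> END_deg G scale V \<sigma>"
    show "x + y \<in> END_deg G scale V \<sigma>"
      using xy[THEN END_degD(1)] xy[THEN END_degD(2)] assms subspace_V
      by (intro END_degI) (auto simp: lin_iff subspace_add algebra_simps)
  next
    fix c x
    assume x: "x \<in> END_deg G scale V \<sigma>"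
    show "c \<odot>\<^bsub>END scale\<^esub> x \<in> END_deg G scale V \<sigma>"
      using END_degD[OF x] assms subspace_V
      by (intro END_degI) (auto simp: smult_END lin_iff subspace_scale algebra_simps)
  qed
qed

lemma END_deg_disjoint:
  assumes "f \<in> END_deg G scale V \<sigma>" "f \<in> END_deg G scale V \<tau>"
    and "\<sigma> \<in> carrier G" "\<tau> \<in> carrier G" "\<sigma> \<noteq> \<tau>"
  shows "f = 0"
proof (rule ccontr)
  assume "f \<noteq> 0"
  then obtain v where "f v \<noteq> 0" by (auto simp: fun_eq_iff)
  then obtain g w where g: "g \<in> carrier G" and w: "w \<in> V g" "f w \<noteq> 0"
    using lin_nonzero_homogeneous END_degD(1)[OF assms(1)] by blast
  then show False
    using V_disjoint[of "f w" "\<sigma> \<otimes> g" "\<tau> \<otimes> g"] END_degD(2)[OF assms(1) g] END_degD(2)[OF assms(2) g]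
      assms(3-5) by auto
qed

lemma carrier_Aut_gr:
  "\<gamma> \<in> carrier (Aut_gr G (END scale) (END_deg G scale V)) \<longleftrightarrow>
    \<gamma> \<in> Bij (carrier (END scale)) \<and> \<gamma> \<in> ring_iso (END scale) (END scale) \<and>
    (\<forall>c. \<forall>a\<in>carrier (END scale). \<gamma> (c \<odot>\<^bsub>END scale\<^esub> a) = c \<odot>\<^bsub>END scale\<^esub> \<gamma> a) \<and>
    (\<forall>\<sigma>\<in>carrier G. \<gamma> ` END_deg G scale V \<sigma> \<subseteq> END_deg G scale V \<sigma>)"
  by (simp add: Aut_gr_def)

text \<open>
  Conjugating a map of degree \<open>\<tau>\<close> by \<open>u\<close> of degree \<open>\<sigma>\<close> gives degree \<open>\<sigma> \<tau> \<sigma>\<^sup>-\<^sup>1\<close>, which is \<open>\<tau>\<close> because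
  \<open>G\<close> is abelian.
\<close>

lemma conj_by_in_Aut_gr:
  assumes u: "hiso \<sigma> u" and \<sigma>: "\<sigma> \<in> carrier G"
  shows "conj_by scale u \<in> carrier (Aut_gr G (END scale) (END_deg G scale V))"
proof -
  have "conj_by scale u a \<in> END_deg G scale V \<tau>"
    if a: "a \<in> END_deg G scale V \<tau>" and \<tau>: "\<tau> \<in> carrier G" for a \<tau>
  proof -
    have "u \<circ> a \<circ> inv_into UNIV u \<in> END_deg G scale V (\<sigma> \<otimes> \<tau> \<otimes> inv\<^bsub>G\<^esub> \<sigma>)"
      using \<sigma> \<tau> by (intro END_deg_comp hiso_END_deg hiso_inv u a) auto
    also have "\<sigma> \<otimes> \<tau> \<otimes> inv\<^bsub>G\<^esub> \<sigma> = \<tau>"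
      using \<sigma> \<tau> by (simp add: G.m_comm[of \<sigma> \<tau>] G.m_assoc)
    finally show ?thesis
      by (simp only: conj_by_apply[OF END_degD(1)[OF a]])
  qed
  then show ?thesis
    using hisoD(1,2)[OF u]
    by (simp add: carrier_Aut_gr image_subset_iff conj_by_Bij conj_by_ring_iso conj_by_smult)
qed

section \<open>Graded automorphisms are conjugations by homogeneous maps\<close>

text \<open>
  Homogeneity of \<open>l\<close> and \<open>e\<close> is what makes the rank-one maps \<open>l(-) v\<close> homogeneous for homogeneous
  \<open>v\<close>; a functional of this kind is obtained by composing an arbitrary one with the projection
  to the component of \<open>e\<close>.
\<close>

lemma ex_homogeneous_functional:
  assumes nz: "(UNIV :: 'v set) \<noteq> {0}"
  shows "\<exists>d\<in>carrier G. \<exists>e\<in>V d. \<exists>l. Vector_Spaces.linear scale (*) l \<and> l e = 1 \<and>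
    (\<forall>g\<in>carrier G. g \<noteq> d \<longrightarrow> (\<forall>v\<in>V g. l v = 0))"
proof -
  obtain v :: 'v where "id v \<noteq> 0"
    using nz by auto
  then obtain d e where d: "d \<in> carrier G" and e: "e \<in> V d" "e \<noteq> 0"
    using lin_nonzero_homogeneous[of id v] by (auto simp: lin_iff)
  obtain l where l: "Vector_Spaces.linear scale (*) l" "l e = 1"
    using ex_functional[OF e(2)] by blast
  have "l 0 = 0"
    using functionalD(2)[OF l(1), of 0 0] by simp
  have "Vector_Spaces.linear scale (*) (\<lambda>v. l (hcomp d v))"
    using l(1) linD[OF lin_hcomp[OF d]] by (auto simp: Vector_Spaces.linear_iff)
  moreover have "l (hcomp d e) = 1"
    using hcomp_homogeneous[OF e(1) d d] l(2) by simp
  moreover have "\<forall>g\<in>carrier G. g \<noteq> d \<longrightarrow> (\<forall>v\<in>V g. l (hcomp d v) = 0)"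
    using hcomp_homogeneous d \<open>l 0 = 0\<close> by auto
  ultimately show ?thesis
    using d e(1) by (intro bexI[of _ d] bexI[of _ e] exI[of _ "\<lambda>v. l (hcomp d v)"]) auto
qed

text \<open>
  A graded form of the Skolem--Noether theorem.  Write \<open>E v\<close> for the rank-one map \<open>l(-) v\<close>, with
  \<open>e\<close> of degree \<open>d\<close>, \<open>l\<close> vanishing in all other degrees and \<open>l e = 1\<close>.  Since \<open>a \<circ> E v = E (a v)\<close>, the map
  \<open>u v = \<gamma> (E v) w\<close> satisfies \<open>u (a v) = \<gamma> a (u v)\<close> for every \<open>w\<close>.  Choosing \<open>w\<close> homogeneous, of
  degree \<open>h\<close>, with \<open>\<gamma> (E e) w \<noteq> 0\<close> makes \<open>u\<close> nonzero, hence bijective.  It is also homogeneous: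
  for \<open>v\<close> of degree \<open>g\<close> the map \<open>E v\<close>, and therefore \<open>\<gamma> (E v)\<close>, has degree \<open>g d\<^sup>-\<^sup>1\<close>, so \<open>u v\<close> has
  degree \<open>g d\<^sup>-\<^sup>1 h = (h d\<^sup>-\<^sup>1) g\<close>.
\<close>

lemma Aut_gr_is_conj_by:
  assumes nz: "(UNIV :: 'v set) \<noteq> {0}"
    and \<gamma>: "\<gamma> \<in> carrier (Aut_gr G (END scale) (END_deg G scale V))"
  shows "\<exists>\<sigma>\<in>carrier G. \<exists>u. hiso \<sigma> u \<and> \<gamma> = conj_by scale u"
proof -
  have hom: "\<gamma> \<in> ring_hom (END scale) (END scale)" and Bij: "\<gamma> \<in> Bij (carrier (END scale))"
    using \<gamma> by (auto simp: carrier_Aut_gr ring_iso_def)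
  have \<gamma>_lin: "lin (\<gamma> a)" if "lin a" for a
    using ring_hom_memE(1)[OF hom] that by (simp add: carrier_END)
  have \<gamma>_comp: "\<gamma> (a \<circ> b) = \<gamma> a \<circ> \<gamma> b" if "lin a" "lin b" for a b
    using ring_hom_memE(2)[OF hom] that by (simp add: carrier_END mult_END)
  have \<gamma>_add: "\<gamma> (a + b) = \<gamma> a + \<gamma> b" if "lin a" "lin b" for a b
    using ring_hom_memE(3)[OF hom] that by (simp add: carrier_END add_END)
  have \<gamma>_smult: "\<gamma> (\<lambda>v. c *s a v) = (\<lambda>v. c *s \<gamma> a v)" if "lin a" for a c
    using \<gamma> that by (simp add: carrier_Aut_gr carrier_END smult_END)
  have \<gamma>_bij: "bij_betw \<gamma> {a. lin a} {a. lin a}"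
    using Bij by (simp add: Bij_def carrier_END)
  have \<gamma>_surj: "\<exists>a. lin a \<and> \<gamma> a = b" if "lin b" for b
    using bij_betw_imp_surj_on[OF \<gamma>_bij] that by (metis imageE mem_Collect_eq)
  have \<gamma>_inj: "a = b" if "lin a" "lin b" "\<gamma> a = \<gamma> b" for a b
    using inj_onD[OF bij_betw_imp_inj_on[OF \<gamma>_bij]] that by simp
  have \<gamma>_deg: "\<gamma> a \<in> END_deg G scale V \<tau>" if "\<tau> \<in> carrier G" "a \<in> END_deg G scale V \<tau>" for a \<tau>
    using \<gamma> that unfolding carrier_Aut_gr by blast

  obtain d e l where d: "d \<in> carrier G" and e: "e \<in> V d"
    and l: "Vector_Spaces.linear scale (*) l" "l e = 1"
    and l0: "\<And>g v. g \<in> carrier G \<Longrightarrow> g \<noteq> d \<Longrightarrow> v \<in> V g \<Longrightarrow> l v = 0"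
    using ex_homogeneous_functional[OF nz] by blast
  define E where "E v = (\<lambda>x. l x *s v)" for v
  have lin_E: "lin (E v)" for v
    unfolding E_def by (rule lin_rank_one[OF l(1)])
  have E_deg: "E v \<in> END_deg G scale V (g \<otimes> inv\<^bsub>G\<^esub> d)" if "g \<in> carrier G" "v \<in> V g" for g v
  proof (rule END_degI[OF lin_E])
    fix h x
    assume h: "h \<in> carrier G" and x: "x \<in> V h"
    show "E v x \<in> V (g \<otimes> inv\<^bsub>G\<^esub> d \<otimes> h)"
    proof (cases "h = d")
      case True
      then show ?thesis
        using that d subspace_V by (simp add: E_def G.m_assoc subspace_scale)
    next
      case False
      then show ?thesis
        using that d h subspace_V l0[OF h False x] by (simp add: E_def subspace_0)
    qed
  qed
  have "\<gamma> (E e) \<noteq> 0"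
  proof
    assume "\<gamma> (E e) = 0"
    have "\<gamma> 0 = \<gamma> (E 0)"
      by (simp add: E_def zero_fun_def)
    have l0: "lin 0" by (simp add: lin_iff)
    have "\<gamma> 0 = 0"
      using \<gamma>_add[OF l0 l0] by simp
    then have "E e = 0"
      using \<open>\<gamma> (E e) = 0\<close> \<gamma>_inj[OF lin_E l0] by metis
    have "e = 0"
      using l(2) fun_cong[OF \<open>E e = 0\<close>, of e] by (simp add: E_def)
    then show False
      using l(2) functionalD(2)[OF l(1), of 0 0] by simp
  qed
  then obtain x where "\<gamma> (E e) x \<noteq> 0"
    by (auto simp: fun_eq_iff)
  then obtain h w where h: "h \<in> carrier G" and w: "w \<in> V h" "\<gamma> (E e) w \<noteq> 0"
    using lin_nonzero_homogeneous[OF \<gamma>_lin[OF lin_E]] by blast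
  define u where "u v = \<gamma> (E v) w" for v
  have lin_u: "lin u"
    unfolding lin_iff
  proof (intro conjI allI)
    fix x y
    have "E (x + y) = E x + E y"
      by (simp add: E_def fun_eq_iff algebra_simps)
    then show "u (x + y) = u x + u y"
      by (simp add: u_def \<gamma>_add lin_E)
  next
    fix c x
    have "E (c *s x) = (\<lambda>v. c *s E x v)"
      by (simp add: E_def fun_eq_iff algebra_simps)
    then show "u (c *s x) = c *s u x"
      by (simp add: u_def \<gamma>_smult lin_E)
  qed
  have inter: "\<gamma> a \<circ> u = u \<circ> a" if a: "lin a" for a
  proof
    fix v
    have "E (a v) = a \<circ> E v"
      using linD(2)[OF a] by (simp add: E_def fun_eq_iff)
    then show "(\<gamma> a \<circ> u) v = (u \<circ> a) v"
      by (simp add: u_def \<gamma>_comp a lin_E)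
  qed
  have "bij u"
    by (rule intertwiner_bij[of u e \<gamma>]) (use w lin_u \<gamma>_lin \<gamma>_surj inter in \<open>auto simp: u_def\<close>)
  moreover have "u ` V g \<subseteq> V (h \<otimes> inv\<^bsub>G\<^esub> d \<otimes> g)" if g: "g \<in> carrier G" for g
  proof -
    have "u v \<in> V (g \<otimes> inv\<^bsub>G\<^esub> d \<otimes> h)" if "v \<in> V g" for v
      using END_degD(2)[OF \<gamma>_deg[OF _ E_deg[OF g that]] h w(1)] g d by (simp add: u_def)
    moreover have "g \<otimes> inv\<^bsub>G\<^esub> d \<otimes> h = h \<otimes> inv\<^bsub>G\<^esub> d \<otimes> g"
      using g d h by (simp add: G.m_ac)
    ultimately show ?thesis by auto
  qed
  ultimately have "hiso (h \<otimes> inv\<^bsub>G\<^esub> d) u"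
    using lin_u h d by (intro bij_homogeneous_imp_hiso) auto
  moreover have "\<gamma> = conj_by scale u"
  proof
    fix a
    show "\<gamma> a = conj_by scale u a"
    proof (cases "lin a")
      case True
      have "\<gamma> a = \<gamma> a \<circ> (u \<circ> inv_into UNIV u)"
        using \<open>bij u\<close> by (simp add: bij_is_surj surj_iff[THEN iffD1])
      also have "\<dots> = conj_by scale u a"
        by (simp add: conj_by_apply True inter flip: comp_assoc)
      finally show ?thesis .
    next
      case False
      then show ?thesis
        using Bij by (auto simp: conj_by_def carrier_END Bij_def extensional_def)
    qed
  qed
  ultimately show ?thesis
    using h d by blast
qed

section \<open>The groups of the sequence\<close>

text \<open>
  An isomorphism from \<open>V(\<sigma>)\<close> to \<open>V\<close> carries \<open>V (g \<otimes> \<sigma>)\<close> to \<open>V g\<close>, that is, it lowers degrees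
  by \<open>\<sigma>\<close>; so it is its inverse that has degree \<open>\<sigma>\<close>.
\<close>

lemma inertia_group_carrier:
  "carrier (inertia_group G scale V) = {\<sigma> \<in> carrier G. \<exists>u. hiso \<sigma> u}"
proof -
  have "graded_isomorphic G scale UNIV (shift G V \<sigma>) scale UNIV V \<longleftrightarrow> (\<exists>u. hiso \<sigma> u)"
    if \<sigma>: "\<sigma> \<in> carrier G" for \<sigma>
  proof
    assume "graded_isomorphic G scale UNIV (shift G V \<sigma>) scale UNIV V"
    then obtain f where f: "bij f" "lin f" "\<And>g. g \<in> carrier G \<Longrightarrow> f ` V (g \<otimes> \<sigma>) = V g"
      by (auto simp: graded_isomorphic_def shift_def lin_iff)
    have "inv_into UNIV f ` V g = V (\<sigma> \<otimes> g)" if "g \<in> carrier G" for g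
      using f(1) f(3)[OF that, symmetric] that \<sigma> by (simp add: image_inv_f_f bij_is_inj G.m_comm)
    then show "\<exists>u. hiso \<sigma> u"
      using f(1,2) by (intro exI[of _ "inv_into UNIV f"])
        (simp add: homogeneous_iso_def lin_inv_into bij_imp_bij_inv)
  next
    assume "\<exists>u. hiso \<sigma> u"
    then obtain u where u: "hiso \<sigma> u" ..
    have "inv_into UNIV u ` V (g \<otimes> \<sigma>) = V g" if "g \<in> carrier G" for g
      using hisoD(2,3)[OF u] that \<sigma> by (metis G.m_comm bij_is_inj image_inv_f_f)
    then show "graded_isomorphic G scale UNIV (shift G V \<sigma>) scale UNIV V"
      using lin_inv_into[OF hisoD(1,2)[OF u]] bij_imp_bij_inv[OF hisoD(2)[OF u]]
      unfolding graded_isomorphic_def shift_def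
      by (intro exI[of _ "inv_into UNIV u"]) (simp add: lin_iff)
  qed
  then show ?thesis
    by (auto simp: inertia_group_def)
qed

lemma group_inertia_group: "group (inertia_group G scale V)"
proof -
  have eq: "inertia_group G scale V = G\<lparr>carrier := {\<sigma> \<in> carrier G. \<exists>u. hiso \<sigma> u}\<rparr>"
    using inertia_group_carrier by (simp add: inertia_group_def)
  have "subgroup {\<sigma> \<in> carrier G. \<exists>u. hiso \<sigma> u} G"
  proof (rule G.subgroupI)
    show "{\<sigma> \<in> carrier G. \<exists>u. hiso \<sigma> u} \<noteq> {}"
      using hiso_id G.one_closed by blast
  next
    fix \<sigma>
    assume "\<sigma> \<in> {\<sigma> \<in> carrier G. \<exists>u. hiso \<sigma> u}"
    then show "inv\<^bsub>G\<^esub> \<sigma> \<in> {\<sigma> \<in> carrier G. \<exists>u. hiso \<sigma> u}"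
      using hiso_inv G.inv_closed by blast
  next
    fix \<sigma> \<tau>
    assume "\<sigma> \<in> {\<sigma> \<in> carrier G. \<exists>u. hiso \<sigma> u}" "\<tau> \<in> {\<sigma> \<in> carrier G. \<exists>u. hiso \<sigma> u}"
    then show "\<sigma> \<otimes> \<tau> \<in> {\<sigma> \<in> carrier G. \<exists>u. hiso \<sigma> u}"
      using hiso_comp G.m_closed by blast
  qed blast
  then show ?thesis
    unfolding eq by (rule G.subgroup_imp_group)
qed

text \<open>
  Both groups of automorphisms in the sequence have this form: \<open>K\<close> is the whole of \<open>G\<close> for the
  graded automorphisms and trivial for the inner ones.
\<close>

definition conjugations :: "'g set \<Rightarrow> (('v \<Rightarrow> 'v) \<Rightarrow> ('v \<Rightarrow> 'v)) set"
  where "conjugations K = {conj_by scale u | u \<sigma>. \<sigma> \<in> K \<and> hiso \<sigma> u}"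

lemma conjugationsI: "\<sigma> \<in> K \<Longrightarrow> hiso \<sigma> u \<Longrightarrow> conj_by scale u \<in> conjugations K"
  unfolding conjugations_def by blast

lemma conjugationsE:
  assumes "x \<in> conjugations K"
  obtains \<sigma> u where "\<sigma> \<in> K" "hiso \<sigma> u" "x = conj_by scale u"
  using assms unfolding conjugations_def by blast

lemma subgroup_conjugations:
  assumes K: "subgroup K G"
  shows "subgroup (conjugations K) (BijGroup (carrier (END scale)))"
proof (rule subgroup.intro)
  show "conjugations K \<subseteq> carrier (BijGroup (carrier (END scale)))"
    using conj_by_Bij hisoD(1,2) by (auto simp: BijGroup_def elim!: conjugationsE)
next
  fix x y
  assume "x \<in> conjugations K" "y \<in> conjugations K"
  then obtain \<sigma> u \<tau> v where \<sigma>: "\<sigma> \<in> K" and u: "hiso \<sigma> u" and x: "x = conj_by scale u"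
    and \<tau>: "\<tau> \<in> K" and v: "hiso \<tau> v" and y: "y = conj_by scale v"
    by (metis conjugationsE)
  have "hiso (\<sigma> \<otimes> \<tau>) (u \<circ> v)"
    using subgroup.mem_carrier[OF K] \<sigma> \<tau> by (intro hiso_comp u v)
  then have "conj_by scale (u \<circ> v) \<in> conjugations K"
    by (rule conjugationsI[OF subgroup.m_closed[OF K \<sigma> \<tau>]])
  then show "x \<otimes>\<^bsub>BijGroup (carrier (END scale))\<^esub> y \<in> conjugations K"
    by (simp only: x y conj_by_mult[OF hisoD(1,2)[OF u] hisoD(1,2)[OF v]])
next
  have "\<one>\<^bsub>BijGroup (carrier (END scale))\<^esub> = conj_by scale id"
    by (simp add: conj_by_identity BijGroup_def)
  then show "\<one>\<^bsub>BijGroup (carrier (END scale))\<^esub> \<in> conjugations K"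
    using conjugationsI[OF subgroup.one_closed[OF K] hiso_id] by simp
next
  fix x
  assume "x \<in> conjugations K"
  then obtain \<sigma> u where \<sigma>: "\<sigma> \<in> K" and u: "hiso \<sigma> u" and x: "x = conj_by scale u"
    by (rule conjugationsE)
  have "hiso (inv\<^bsub>G\<^esub> \<sigma>) (inv_into UNIV u)"
    by (rule hiso_inv[OF u subgroup.mem_carrier[OF K \<sigma>]])
  then have "conj_by scale (inv_into UNIV u) \<in> conjugations K"
    by (rule conjugationsI[OF subgroup.m_inv_closed[OF K \<sigma>]])
  then show "inv\<^bsub>BijGroup (carrier (END scale))\<^esub> x \<in> conjugations K"
    by (simp only: x conj_by_inv[OF hisoD(1,2)[OF u]])
qed

lemma Aut_gr_eq_conjugations:
  assumes nz: "(UNIV :: 'v set) \<noteq> {0}"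
  shows "Aut_gr G (END scale) (END_deg G scale V) =
    BijGroup (carrier (END scale))\<lparr>carrier := conjugations (carrier G)\<rparr>"
proof -
  have "carrier (Aut_gr G (END scale) (END_deg G scale V)) = conjugations (carrier G)"
  proof (intro equalityI subsetI)
    fix \<gamma>
    assume "\<gamma> \<in> carrier (Aut_gr G (END scale) (END_deg G scale V))"
    from Aut_gr_is_conj_by[OF nz this] show "\<gamma> \<in> conjugations (carrier G)"
      by (auto intro: conjugationsI)
  qed (auto elim!: conjugationsE intro: conj_by_in_Aut_gr)
  then show ?thesis
    by (simp add: Aut_gr_def)
qed

lemma INN_eq_conjugations:
  "INN G scale V = BijGroup (carrier (END scale))\<lparr>carrier := conjugations {\<one>}\<rparr>"
proof -
  have "hiso \<one> f \<longleftrightarrow> lin f \<and> bij f \<and> (\<forall>g\<in>carrier G. f ` V g = V g)" for f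
    by (simp add: homogeneous_iso_def)
  then show ?thesis
    by (simp add: INN_def conjugations_def conj_by_def)
qed

section \<open>The twisted centralizer of a conjugation\<close>

text \<open>
  The twisted centralizer is spanned by \<open>u\<^sup>-\<^sup>1\<close>, which has degree \<open>\<sigma>\<^sup>-\<^sup>1\<close>, and a nonzero
  endomorphism has at most one degree.
\<close>

lemma twisted_centralizer_deg_conj_by:
  assumes u: "hiso \<sigma> u" and \<sigma>: "\<sigma> \<in> carrier G" and g: "g \<in> carrier G"
  shows "twisted_centralizer_deg G scale V (conj_by scale u) g =
    (if g = inv\<^bsub>G\<^esub> \<sigma> then twisted_centralizer (END scale) (conj_by scale u) else {0})"
proof -
  interpret F: vector_space "smult (END scale)"
    using vector_space_fun by (simp add: smult_END)
  let ?I = "twisted_centralizer (END scale) (conj_by scale u)"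
  have I: "?I = range (\<lambda>c. smult (END scale) c (inv_into UNIV u))"
    by (rule twisted_centralizer_conj_by[OF hisoD(1,2)[OF u]])
  have sub: "?I \<subseteq> END_deg G scale V (inv\<^bsub>G\<^esub> \<sigma>)"
    unfolding I using F.subspace_scale[OF subspace_END_deg] hiso_END_deg[OF hiso_inv[OF u \<sigma>]] \<sigma> by auto
  have "0 \<in> ?I"
    unfolding I by (rule image_eqI[of _ _ 0]) auto
  moreover have "x = 0" if "x \<in> ?I" "x \<in> END_deg G scale V g" "g \<noteq> inv\<^bsub>G\<^esub> \<sigma>" for x
    using END_deg_disjoint[of x g "inv\<^bsub>G\<^esub> \<sigma>"] that sub g \<sigma> by auto
  moreover have "0 \<in> END_deg G scale V g"
    by (rule F.subspace_0[OF subspace_END_deg[OF g]])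
  ultimately show ?thesis
    using sub by (auto simp: twisted_centralizer_deg_def)
qed

lemma inv_into_hiso_nonzero:
  assumes nz: "(UNIV :: 'v set) \<noteq> {0}" and u: "hiso \<sigma> u"
  shows "inv_into UNIV u \<noteq> 0"
proof
  assume "inv_into UNIV u = 0"
  then have "v = u 0" for v
    using hisoD(2)[OF u] by (metis bij_inv_eq_iff zero_fun_apply)
  then show False
    using nz linD(3)[OF hisoD(1)[OF u]] by auto
qed

lemma grading_concentrated:
  assumes vs: "vector_space s" and S: "module.subspace s S" and \<rho>: "\<rho> \<in> carrier G"
    and W: "\<And>g. g \<in> carrier G \<Longrightarrow> W g = (if g = \<rho> then S else {0})"
  shows "grading G s S W"
proof -
  interpret F: vector_space s by (rule vs)
  have "\<exists>!w. w \<in> (\<Pi>\<^sub>E g\<in>carrier G. W g) \<and> v = (\<Sum>g\<in>carrier G. w g)" if v: "v \<in> S" for v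
  proof (rule ex1I)
    let ?w = "\<lambda>g\<in>carrier G. if g = \<rho> then v else 0"
    show "?w \<in> (\<Pi>\<^sub>E g\<in>carrier G. W g) \<and> v = (\<Sum>g\<in>carrier G. ?w g)"
      using v W \<rho> finite_G by auto
    fix w
    assume w: "w \<in> (\<Pi>\<^sub>E g\<in>carrier G. W g) \<and> v = (\<Sum>g\<in>carrier G. w g)"
    have w0: "w g = 0" if "g \<in> carrier G" "g \<noteq> \<rho>" for g
      using w W that by fastforce
    have "v = w \<rho>"
      using w w0 sum.remove[OF finite_G \<rho>, of w] by simp
    then show "w = ?w"
      using w w0 by (auto simp: fun_eq_iff PiE_def extensional_def)
  qed
  then show ?thesis
    using S W F.subspace_0[OF S] by (auto simp: grading_def F.subspace_single_0)
qed

text \<open>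
  The line spanned by \<open>u\<^sup>-\<^sup>1\<close> lives in degree \<open>\<sigma>\<^sup>-\<^sup>1\<close>, which is also where \<open>k(\<sigma>)\<close> lives: its component
  in degree \<open>g\<close> is the degree \<open>g \<sigma>\<close> component of \<open>k\<close>.  The isomorphism reads off the coefficient of
  \<open>u\<^sup>-\<^sup>1\<close>.
\<close>

lemma twist_type_conj_by:
  assumes nz: "(UNIV :: 'v set) \<noteq> {0}" and u: "hiso \<sigma> u"
    and \<sigma>: "\<sigma> \<in> carrier G" and \<tau>: "\<tau> \<in> carrier G"
  shows "twist_type G scale V (conj_by scale u) \<tau> \<longleftrightarrow> \<tau> = \<sigma>"
proof -
  interpret F: vector_space "smult (END scale)"
    using vector_space_fun by (simp add: smult_END)
  let ?I = "twisted_centralizer (END scale) (conj_by scale u)"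
  let ?x = "inv_into UNIV u"
  have I: "?I = range (\<lambda>c. smult (END scale) c ?x)"
    by (rule twisted_centralizer_conj_by[OF hisoD(1,2)[OF u]])
  show ?thesis
  proof
    assume "twist_type G scale V (conj_by scale u) \<tau>"
    then obtain f :: "_ \<Rightarrow> 'k" where f: "bij_betw f ?I UNIV"
      and fg: "\<forall>g\<in>carrier G. f ` twisted_centralizer_deg G scale V (conj_by scale u) g =
        shift G (ground_grading G) \<tau> g"
      unfolding twist_type_def graded_isomorphic_def by - (elim exE conjE, rule that)
    have "shift G (ground_grading G) \<tau> (inv\<^bsub>G\<^esub> \<sigma>) = (UNIV :: 'k set)"
      using bspec[OF fg, of "inv\<^bsub>G\<^esub> \<sigma>"] f \<sigma> by (simp add: twisted_centralizer_deg_conj_by[OF u \<sigma>] bij_betw_def)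
    moreover have "(UNIV :: 'k set) \<noteq> {0}"
      using zero_neq_one by (metis UNIV_I singletonD)
    ultimately have "inv\<^bsub>G\<^esub> \<sigma> \<otimes> \<tau> = \<one>"
      by (auto simp: shift_def ground_grading_def split: if_splits)
    then show "\<tau> = \<sigma>"
      using \<sigma> \<tau> by (metis G.inv_closed G.inv_equality G.inv_inv G.m_comm)
  next
    assume [simp]: "\<tau> = \<sigma>"
    define f where "f = inv_into UNIV (\<lambda>c. smult (END scale) c ?x)"
    have inj: "inj (\<lambda>c. smult (END scale) c ?x)"
      using inv_into_hiso_nonzero[OF nz u] by (auto simp: inj_on_def)
    have f: "f (smult (END scale) c ?x) = c" for c
      unfolding f_def using inv_into_f_f[OF inj] by simp
    have bij: "bij_betw f ?I UNIV"
      unfolding I f_def using inj by (simp add: bij_betw_inv_into inj_imp_bij_betw_inv)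
    have "\<forall>x\<in>?I. \<forall>y\<in>?I. f (x + y) = f x + f y"
      by (auto simp: I f simp flip: F.scale_left_distrib)
    moreover have "\<forall>c. \<forall>x\<in>?I. f (smult (END scale) c x) = c * f x"
      by (auto simp: I f)
    moreover have "f ` twisted_centralizer_deg G scale V (conj_by scale u) g =
        shift G (ground_grading G) \<sigma> g" if g: "g \<in> carrier G" for g
    proof -
      have "g \<otimes> \<sigma> = \<one> \<longleftrightarrow> g = inv\<^bsub>G\<^esub> \<sigma>"
        using g \<sigma> G.inv_equality by auto
      moreover have "f 0 = 0"
        using f[of 0] by simp
      moreover have "f ` ?I = UNIV"
        by (rule bij_betw_imp_surj_on[OF bij])
      ultimately show ?thesis
        using g \<sigma> by (simp add: twisted_centralizer_deg_conj_by[OF u] shift_def ground_grading_def)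
    qed
    ultimately show "twist_type G scale V (conj_by scale u) \<tau>"
      using bij unfolding twist_type_def graded_isomorphic_def by (intro exI[of _ f]) simp
  qed
qed

lemma phi_conj_by:
  assumes nz: "(UNIV :: 'v set) \<noteq> {0}" and u: "hiso \<sigma> u" and \<sigma>: "\<sigma> \<in> carrier G"
  shows "phi G scale V (conj_by scale u) = \<sigma>"
  unfolding phi_def using twist_type_conj_by[OF nz u \<sigma>] \<sigma> by blast

lemma twisted_centralizer_graded_line:
  assumes nz: "(UNIV :: 'v set) \<noteq> {0}" and u: "hiso \<sigma> u" and \<sigma>: "\<sigma> \<in> carrier G"
  shows "grading G (smult (END scale)) (twisted_centralizer (END scale) (conj_by scale u))
      (twisted_centralizer_deg G scale V (conj_by scale u))"
    and "vector_space.dim (smult (END scale)) (twisted_centralizer (END scale) (conj_by scale u)) = 1"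
proof -
  interpret F: vector_space "smult (END scale)"
    using vector_space_fun by (simp add: smult_END)
  have I: "twisted_centralizer (END scale) (conj_by scale u) = F.span {inv_into UNIV u}"
    by (simp add: twisted_centralizer_conj_by[OF hisoD(1,2)[OF u]] F.span_singleton)
  show "grading G (smult (END scale)) (twisted_centralizer (END scale) (conj_by scale u))
      (twisted_centralizer_deg G scale V (conj_by scale u))"
    by (rule grading_concentrated[of _ _ "inv\<^bsub>G\<^esub> \<sigma>"])
      (use \<sigma> F.vector_space_axioms in \<open>simp_all add: I twisted_centralizer_deg_conj_by[OF u]\<close>)
  show "F.dim (twisted_centralizer (END scale) (conj_by scale u)) = 1"
    using inv_into_hiso_nonzero[OF nz u] by (simp add: I F.dim_eq_card_independent F.dependent_single)
qed

section \<open>Exactness\<close>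

text \<open>
  Everything follows from \<open>phi (conj_by u) = deg u\<close>.  Degrees multiply under composition, so \<open>phi\<close> is a
  homomorphism; its kernel consists of the conjugations by maps of degree \<open>\<one>\<close>; and its image
  consists of the degrees of all homogeneous isomorphisms, which form the inertia group.
\<close>

lemma short_exact_INN_Aut_gr_inertia_group:
  assumes nz: "(UNIV :: 'v set) \<noteq> {0}"
  shows "short_exact_groups (INN G scale V) (\<lambda>\<gamma>. \<gamma>)
    (Aut_gr G (END scale) (END_deg G scale V)) (phi G scale V) (inertia_group G scale V)"
proof -
  let ?H = "Aut_gr G (END scale) (END_deg G scale V)"
  note H = Aut_gr_eq_conjugations[OF nz] and K = INN_eq_conjugations
  note phi = phi_conj_by[OF nz]
  have mult_I: "monoid.mult (inertia_group G scale V) = monoid.mult G"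
    and one_I: "\<one>\<^bsub>inertia_group G scale V\<^esub> = \<one>"
    by (simp_all add: inertia_group_def)
  have gH: "group ?H"
    unfolding H by (rule group.subgroup_imp_group[OF group_BijGroup subgroup_conjugations[OF G.subgroup_self]])
  have gK: "group (INN G scale V)"
    unfolding K by (rule group.subgroup_imp_group[OF group_BijGroup subgroup_conjugations[OF G.triv_subgroup]])
  have "conjugations {\<one>} \<subseteq> conjugations (carrier G)"
    using conjugationsI G.one_closed by (blast elim: conjugationsE)
  then have "group_hom (INN G scale V) ?H (\<lambda>\<gamma>. \<gamma>)"
    using gH gK by (auto simp: group_hom_def group_hom_axioms_def hom_def H K)
  moreover have "phi G scale V \<in> hom ?H (inertia_group G scale V)"
  proof (rule homI)
    fix x
    assume "x \<in> carrier ?H"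
    then show "phi G scale V x \<in> carrier (inertia_group G scale V)"
      by (auto simp: H phi inertia_group_carrier elim!: conjugationsE)
  next
    fix x y
    assume "x \<in> carrier ?H" "y \<in> carrier ?H"
    then obtain \<sigma> u \<tau> v where u: "\<sigma> \<in> carrier G" "hiso \<sigma> u" "x = conj_by scale u"
      and v: "\<tau> \<in> carrier G" "hiso \<tau> v" "y = conj_by scale v"
      unfolding H by (auto elim!: conjugationsE)
    then have "x \<otimes>\<^bsub>?H\<^esub> y = conj_by scale (u \<circ> v)"
      using conj_by_mult[OF hisoD(1,2)[OF u(2)] hisoD(1,2)[OF v(2)]] by (simp add: H)
    moreover have "hiso (\<sigma> \<otimes> \<tau>) (u \<circ> v)"
      using u v hiso_comp by blast
    ultimately show "phi G scale V (x \<otimes>\<^bsub>?H\<^esub> y) =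
        phi G scale V x \<otimes>\<^bsub>inertia_group G scale V\<^esub> phi G scale V y"
      using u v by (simp add: phi mult_I)
  qed
  then have "group_hom ?H (inertia_group G scale V) (phi G scale V)"
    using gH group_inertia_group by (simp add: group_hom_def group_hom_axioms_def)
  moreover have "carrier (INN G scale V) = kernel ?H (inertia_group G scale V) (phi G scale V)"
    using conjugationsI by (auto simp: kernel_def H K one_I phi elim!: conjugationsE)
  moreover have "phi G scale V ` carrier ?H = carrier (inertia_group G scale V)"
  proof (intro equalityI subsetI)
    fix \<sigma>
    assume "\<sigma> \<in> phi G scale V ` carrier ?H"
    then show "\<sigma> \<in> carrier (inertia_group G scale V)"
      by (auto simp: H phi inertia_group_carrier elim!: conjugationsE)
  next
    fix \<sigma>
    assume "\<sigma> \<in> carrier (inertia_group G scale V)"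
    then obtain u where \<sigma>: "\<sigma> \<in> carrier G" and u: "hiso \<sigma> u"
      by (auto simp: inertia_group_carrier)
    show "\<sigma> \<in> phi G scale V ` carrier ?H"
      using phi[OF u \<sigma>] conjugationsI[OF \<sigma> u] unfolding H by (intro image_eqI) simp_all
  qed
  ultimately show ?thesis
    by (simp add: short_exact_groups_def)
qed

end

theorem proposition4p2:
  fixes G :: "('g, 'm) monoid_scheme"
    and scale :: "'k::field \<Rightarrow> 'v \<Rightarrow> 'v::ab_group_add"
    and V :: "'g \<Rightarrow> 'v set"
  assumes "comm_group G" and "finite (carrier G)"
    and "\<exists>B. finite_dimensional_vector_space scale B"
    and "(UNIV :: 'v set) \<noteq> {0}"
    and "grading G scale UNIV V"
  shows "(\<forall>\<gamma> \<in> carrier (Aut_gr G (END scale) (END_deg G scale V)).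
            grading G (smult (END scale))
              (twisted_centralizer (END scale) \<gamma>) (twisted_centralizer_deg G scale V \<gamma>) \<and>
            vector_space.dim (smult (END scale)) (twisted_centralizer (END scale) \<gamma>) = 1 \<and>
            (\<exists>!\<sigma>. \<sigma> \<in> carrier G \<and> twist_type G scale V \<gamma> \<sigma>)) \<and>
         short_exact_groups
           (INN G scale V) (\<lambda>\<gamma>. \<gamma>)
           (Aut_gr G (END scale) (END_deg G scale V)) (phi G scale V)
           (inertia_group G scale V)"
proof -
  obtain B where "finite_dimensional_vector_space scale B"
    using assms(3) by blast
  then interpret vector_space scale
    by (rule finite_dimensional_vector_space.axioms)
  interpret graded_space G scale V
    using assms(1,2,5) vector_space_axioms
    by (simp add: graded_space_def graded_space_axioms_def endomorphism_algebra_def)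
  show ?thesis
  proof (intro conjI ballI)
    fix \<gamma>
    assume "\<gamma> \<in> carrier (Aut_gr G (END scale) (END_deg G scale V))"
    then obtain \<sigma> u where \<sigma>: "\<sigma> \<in> carrier G" and u: "hiso \<sigma> u" and \<gamma>: "\<gamma> = conj_by scale u"
      using Aut_gr_is_conj_by[OF assms(4)] by blast
    show "grading G (smult (END scale)) (twisted_centralizer (END scale) \<gamma>)
        (twisted_centralizer_deg G scale V \<gamma>)"
      and "vector_space.dim (smult (END scale)) (twisted_centralizer (END scale) \<gamma>) = 1"
      unfolding \<gamma> by (fact twisted_centralizer_graded_line[OF assms(4) u \<sigma>])+
    show "\<exists>!\<sigma>. \<sigma> \<in> carrier G \<and> twist_type G scale V \<gamma> \<sigma>"
      unfolding \<gamma> using twist_type_conj_by[OF assms(4) u \<sigma>] \<sigma> by blast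
  qed (fact short_exact_INN_Aut_gr_inertia_group[OF assms(4)])
qed

end
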